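(* Let $G$ be a graph on $n$ vertices and $A\in\mathcal{S}(G)$ a matrix with the SSP (respectively, the SMP). Then for every integer $q'$ with $q(A)\le q'\le n$ there is a matrix $A'\in\mathcal{S}(G)$ with the SSP (respectively, the SMP) such that $q(A')=q'$.
   Context: For a graph $G$ on vertex set $\{1,\ldots,n\}$, $\mathcal{S}(G)$ is the set of real symmetric $n\times n$ matrices whose $(i,j)$-entry for $i\neq j$ is nonzero if and only if $\{i,j\}$ is an edge (diagonal entries arbitrary). $q(A)$ is the number of distinct eigenvalues of $A$. $\circ$ is the entrywise product and $[A,X]=AX-XA$. A symmetric matrix $A$ with $q$ distinct eigenvalues has the SSP if $X=O$ is the only real symmetric matrix with $A\circ X=O$, $I\circ X=O$, $[A,X]=O$; it has the SMP if $X=O$ is the only real symmetric matrix with these three conditions and additionally $\operatorname{tr}(A^kX)=0$ for $k=0,\ldots,q-1$. *)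

theory Defs
  imports "HOL-Analysis.Analysis"
begin

text \<open>A simple graph on the vertex type 'n (vertex set = UNIV, n = CARD('n)),
  given by a symmetric irreflexive adjacency relation.\<close>
definition simple_graph :: "('n \<Rightarrow> 'n \<Rightarrow> bool) \<Rightarrow> bool" where
  "simple_graph E \<longleftrightarrow> (\<forall>i j. E i j \<longrightarrow> E j i) \<and> (\<forall>i. \<not> E i i)"

definition sym_mat :: "real^'n^'n \<Rightarrow> bool" where
  "sym_mat A \<longleftrightarrow> transpose A = A"

definition SG :: "('n::finite \<Rightarrow> 'n \<Rightarrow> bool) \<Rightarrow> (real^'n^'n) set" where
  "SG E = {A. sym_mat A \<and> (\<forall>i j. i \<noteq> j \<longrightarrow> (A $ i $ j \<noteq> 0 \<longleftrightarrow> E i j))}"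

definition eigenvalues :: "real^'n^'n \<Rightarrow> real set" where
  "eigenvalues A = {c. \<exists>v. v \<noteq> 0 \<and> A *v v = c *\<^sub>R v}"

definition qnum :: "real^'n^'n \<Rightarrow> nat" where
  "qnum A = card (eigenvalues A)"

primrec matpow :: "real^'n^'n \<Rightarrow> nat \<Rightarrow> real^'n^'n" where
  "matpow A 0 = mat 1"
| "matpow A (Suc k) = A ** matpow A k"

definition SSP :: "real^'n^'n \<Rightarrow> bool" where
  "SSP A \<longleftrightarrow> (\<forall>X::real^'n^'n. sym_mat X \<and> (\<forall>i j. A $ i $ j * X $ i $ j = 0)
      \<and> (\<forall>i. X $ i $ i = 0) \<and> A ** X - X ** A = 0 \<longrightarrow> X = 0)"

definition SMP :: "real^'n^'n \<Rightarrow> bool" where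
  "SMP A \<longleftrightarrow> (\<forall>X::real^'n^'n. sym_mat X \<and> (\<forall>i j. A $ i $ j * X $ i $ j = 0)
      \<and> (\<forall>i. X $ i $ i = 0) \<and> A ** X - X ** A = 0
      \<and> (\<forall>k < qnum A. trace (matpow A k ** X) = 0) \<longrightarrow> X = 0)"

end

theory Submission
  imports Defs
begin

text \<open>
  Let \<open>A = P diag(d) P\<^sup>T\<close> and consider \<open>(B, C, x) \<mapsto> (C\<^sup>T B C - P diag(x) P\<^sup>T, C\<^sup>T C)\<close> near
  \<open>(A, I, 0)\<close>, where \<open>B\<close> is supported on the graph and \<open>x\<close> is a function of \<open>d\<close>. A pair of
  symmetric matrices \<open>(X, Z)\<close> orthogonal to the image of the derivative has \<open>Z = - A X\<close> and an
  \<open>X\<close> satisfying all the conditions in the SMP. So if \<open>A\<close> has the SMP (in particular, if it has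
  the SSP), every symmetric \<open>M\<close> near \<open>A\<close> becomes orthogonally similar to some \<open>B\<close> in \<open>SG E\<close>
  near \<open>A\<close> after adding a small \<open>P diag(x) P\<^sup>T\<close>. Choose \<open>M\<close> by splitting multiple eigenvalues of
  \<open>A\<close>: the correction shifts each cluster of eigenvalues as a whole, so it does not change the
  number of distinct ones. The SSP and the SMP persist near \<open>A\<close> by compactness of the unit sphere
  of test matrices.
\<close>

section \<open>Orthonormal eigenbases\<close>

lemma semidefinite_isotropic_imp_orthogonal:
  fixes g :: "'a::euclidean_space \<Rightarrow> 'a"
  assumes g: "linear g" "adjoint g = g" and S: "subspace S"
    and nonneg: "\<And>x. x \<in> S \<Longrightarrow> 0 \<le> x \<bullet> g x"
    and v: "v \<in> S" "v \<bullet> g v = 0" and w: "w \<in> S"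
  shows "w \<bullet> g v = 0"
proof -
  define q where "q = (\<lambda>t. (v + t *\<^sub>R w) \<bullet> g (v + t *\<^sub>R w))"
  have "v \<bullet> g w = w \<bullet> g v"
    using adjoint_works[OF g(1), of v w] g(2) by (simp add: inner_commute)
  then have "q = (\<lambda>t. 2 * (w \<bullet> g v) * t + (w \<bullet> g w) * t\<^sup>2)"
    using v(2) by (simp add: q_def fun_eq_iff linear_add[OF g(1)] linear_scale[OF g(1)] inner_simps
        algebra_simps power2_eq_square)
  then have "(q has_real_derivative 2 * (w \<bullet> g v)) (at 0)"
    by (auto intro!: derivative_eq_intros)
  moreover have "q 0 \<le> q t" for t
    using nonneg[of "v + t *\<^sub>R w"] S v w by (simp add: q_def subspace_add subspace_scale)
  ultimately have "2 * (w \<bullet> g v) = 0"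
    by (intro DERIV_local_min[of q _ 0 1]) auto
  then show ?thesis by simp
qed

lemma rayleigh_quotient_maximizer:
  fixes f :: "'a::euclidean_space \<Rightarrow> 'a"
  assumes f: "linear f" and S: "subspace S" "S \<noteq> {0}"
  obtains v where "v \<in> S" "norm v = 1" "\<And>x. x \<in> S \<Longrightarrow> x \<bullet> f x \<le> (v \<bullet> f v) * (x \<bullet> x)"
proof -
  let ?K = "S \<inter> sphere 0 1"
  have normalized: "x /\<^sub>R norm x \<in> ?K" if "x \<in> S" "x \<noteq> 0" for x
    using S that by (simp add: subspace_scale)
  obtain u where "u \<in> S" "u \<noteq> 0" using S subspace_0 by blast
  then have "?K \<noteq> {}" using normalized by blast
  moreover have "compact ?K"
    using S by (simp add: closed_Int_compact closed_subspace)
  moreover have "continuous_on ?K (\<lambda>x. x \<bullet> f x)"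
    using f by (intro continuous_intros linear_continuous_on) (simp add: linear_linear)
  ultimately obtain v where v: "v \<in> ?K" and max: "\<forall>x\<in>?K. x \<bullet> f x \<le> v \<bullet> f v"
    using continuous_attains_sup[of ?K "\<lambda>x. x \<bullet> f x"] by metis
  have "x \<bullet> f x \<le> (v \<bullet> f v) * (x \<bullet> x)" if "x \<in> S" for x
  proof (cases "x = 0")
    case False
    have "(x /\<^sub>R norm x) \<bullet> f (x /\<^sub>R norm x) \<le> v \<bullet> f v"
      by (rule max[rule_format, OF normalized[OF that False]])
    then show ?thesis
      using False
      by (simp add: linear_scale[OF f] dot_square_norm field_simps power2_eq_square)
  qed simp
  with v show thesis by (intro that[of v]) auto
qed

lemma selfadjoint_eigenvector_in_subspace:
  fixes f :: "'a::euclidean_space \<Rightarrow> 'a"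
  assumes f: "linear f" "adjoint f = f"
    and S: "subspace S" "f ` S \<subseteq> S" "S \<noteq> {0}"
  obtains v c where "v \<in> S" "norm v = 1" "f v = c *\<^sub>R v"
proof -
  obtain v where v: "v \<in> S" "norm v = 1"
    and max: "\<And>x. x \<in> S \<Longrightarrow> x \<bullet> f x \<le> (v \<bullet> f v) * (x \<bullet> x)"
    using rayleigh_quotient_maximizer[OF f(1) S(1,3)] by metis
  define g where "g = (\<lambda>x. (v \<bullet> f v) *\<^sub>R x - f x)"
  have g: "linear g"
    unfolding g_def using f(1) by (intro linear_compose_sub linear_compose_scale_right linear_ident)
  have g_adjoint: "adjoint g = g"
    using adjoint_works[OF f(1)] f(2) by (intro adjoint_unique) (simp add: g_def inner_diff)
  have g_nonneg: "0 \<le> x \<bullet> g x" if "x \<in> S" for x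
    using max[OF that] by (simp add: g_def inner_diff)
  have "v \<bullet> g v = 0"
    using v by (simp add: g_def inner_diff dot_square_norm)
  moreover have "g v \<in> S"
    using S v by (auto simp: g_def subspace_diff subspace_scale)
  ultimately have "g v \<bullet> g v = 0"
    using semidefinite_isotropic_imp_orthogonal[OF g g_adjoint S(1) g_nonneg v(1)] by blast
  then show thesis using that[of v "v \<bullet> f v"] v by (simp add: g_def)
qed

lemma span_insert_orthogonal_complement:
  fixes S :: "'a::real_inner set"
  assumes S: "subspace S" and v: "v \<in> S" and V: "span V = S \<inter> {x. orthogonal v x}"
  shows "span (insert v V) = S"
proof
  have "V \<subseteq> S" using V span_superset by blast
  then show "span (insert v V) \<subseteq> S" using S v by (intro span_minimal) auto
  show "S \<subseteq> span (insert v V)"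
  proof
    fix x assume "x \<in> S"
    then have "x - (v \<bullet> x / (v \<bullet> v)) *\<^sub>R v \<in> span V"
      using S v by (simp add: V subspace_diff subspace_scale orthogonal_def inner_diff_right)
    then show "x \<in> span (insert v V)" unfolding span_insert by blast
  qed
qed

lemma selfadjoint_orthonormal_eigenbasis:
  fixes f :: "'a::euclidean_space \<Rightarrow> 'a"
  assumes f: "linear f" "adjoint f = f" and S: "subspace S" "f ` S \<subseteq> S"
  shows "\<exists>V. pairwise orthogonal V \<and> span V = S \<and> (\<forall>v\<in>V. norm v = 1 \<and> (\<exists>c. f v = c *\<^sub>R v))"
  using S
proof (induction "dim S" arbitrary: S rule: less_induct)
  case less
  show ?case
  proof (cases "S = {0}")
    case True
    then show ?thesis by (intro exI[of _ "{}"]) simp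
  next
    case False
    then obtain v c where v: "v \<in> S" "norm v = 1" "f v = c *\<^sub>R v"
      using selfadjoint_eigenvector_in_subspace[OF f less.prems] by blast
    define T where "T = S \<inter> {x. orthogonal v x}"
    have T: "subspace T"
      unfolding T_def by (intro subspace_inter less.prems subspace_orthogonal_to_vector)
    have "v \<bullet> f x = c * (v \<bullet> x)" for x
      using adjoint_works[OF f(1), of v x] f(2) v(3) by simp
    then have "f ` T \<subseteq> T"
      using less.prems by (auto simp: T_def orthogonal_def)
    moreover have "dim T < dim S"
    proof -
      have "v \<notin> T" using v(2) by (auto simp: T_def orthogonal_self)
      then have "T \<subset> S" using v(1) by (auto simp: T_def)
      then show ?thesis
        using T less.prems by (metis dim_psubset span_eq_iff)
    qed
    ultimately obtain V where V: "pairwise orthogonal V" "span V = T"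
        "\<forall>u\<in>V. norm u = 1 \<and> (\<exists>c. f u = c *\<^sub>R u)"
      using less.hyps T by blast
    have "V \<subseteq> T" using V(2) span_superset by blast
    have "span (insert v V) = S"
      using span_insert_orthogonal_complement[OF less.prems(1) v(1)] V(2) by (simp add: T_def)
    moreover have "pairwise orthogonal (insert v V)"
      using V(1) \<open>V \<subseteq> T\<close> by (auto simp: pairwise_insert T_def orthogonal_commute)
    ultimately show ?thesis using V(3) v by (intro exI[of _ "insert v V"]) auto
  qed
qed

section \<open>Spectral decomposition of real symmetric matrices\<close>

definition diag_mat :: "real^'n \<Rightarrow> real^'n^'n" where
  "diag_mat x = (\<chi> i j. if i = j then x $ i else 0)"

definition spectral_mat :: "real^'n^'n \<Rightarrow> real^'n \<Rightarrow> real^'n^'n" where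
  "spectral_mat P x = P ** diag_mat x ** transpose P"

lemma diag_mat_mult_vec: "diag_mat x *v v = (\<chi> i. x $ i * v $ i)"
  by (simp add: diag_mat_def matrix_vector_mult_def vec_eq_iff if_distrib if_distribR cong: if_cong)

lemma matrix_mult_diag_mat: "P ** diag_mat x = (\<chi> i j. P $ i $ j * x $ j)"
  by (simp add: diag_mat_def matrix_matrix_mult_def vec_eq_iff if_distrib cong: if_cong)

lemma spectral_mat_entry: "spectral_mat P x $ i $ j = (\<Sum>k\<in>UNIV. P $ i $ k * x $ k * P $ j $ k)"
  unfolding spectral_mat_def matrix_mult_diag_mat
  by (simp add: matrix_matrix_mult_def transpose_def)

lemma linear_spectral_mat: "linear (spectral_mat P)"
  by (rule linearI)
    (simp_all add: vec_eq_iff spectral_mat_entry sum.distrib sum_distrib_left algebra_simps)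

lemma sym_mat_spectral_mat: "sym_mat (spectral_mat P x)"
  by (simp add: sym_mat_def vec_eq_iff spectral_mat_entry transpose_def ac_simps)

lemma spectral_mat_one:
  fixes P :: "real^'n^'n"
  assumes "orthogonal_matrix P"
  shows "spectral_mat P (\<chi> i. 1) = mat 1"
proof -
  have "diag_mat (\<chi> i. 1) = (mat 1 :: real^'n^'n)" by (simp add: diag_mat_def mat_def vec_eq_iff)
  then show ?thesis using assms by (simp add: spectral_mat_def orthogonal_matrix_def)
qed

lemma spectral_mat_mult:
  assumes "orthogonal_matrix P"
  shows "spectral_mat P x ** spectral_mat P y = spectral_mat P (\<chi> i. x $ i * y $ i)"
proof -
  have "spectral_mat P x ** spectral_mat P y
      = P ** diag_mat x ** (transpose P ** P) ** diag_mat y ** transpose P"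
    by (simp only: spectral_mat_def matrix_mul_assoc)
  also have "\<dots> = P ** (diag_mat x ** diag_mat y) ** transpose P"
    using assms by (simp add: orthogonal_matrix matrix_mul_assoc)
  also have "diag_mat x ** diag_mat y = diag_mat (\<chi> i. x $ i * y $ i)"
    by (simp add: matrix_mult_diag_mat) (simp add: diag_mat_def vec_eq_iff)
  finally show ?thesis by (simp only: spectral_mat_def)
qed

lemma matpow_spectral_mat:
  assumes "orthogonal_matrix P"
  shows "matpow (spectral_mat P d) k = spectral_mat P (\<chi> i. d $ i ^ k)"
  by (induction k) (simp_all add: assms spectral_mat_one spectral_mat_mult)

theorem sym_mat_eq_spectral_mat:
  fixes A :: "real^'n^'n"
  assumes "sym_mat A"
  obtains P d where "orthogonal_matrix P" "A = spectral_mat P d"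
proof -
  have "adjoint ((*v) A) = (*v) A"
    using assms adjoint_matrix[of A] by (simp add: sym_mat_def)
  then obtain V where V: "pairwise orthogonal V" "span V = UNIV"
      and eigen: "\<And>v. v \<in> V \<Longrightarrow> norm v = 1 \<and> (\<exists>c. A *v v = c *\<^sub>R v)"
    using selfadjoint_orthonormal_eigenbasis[OF matrix_vector_mul_linear, of A UNIV] by auto
  have "0 \<notin> V" using eigen by force
  then have "independent V" by (rule pairwise_orthogonal_independent[OF V(1)])
  then have "finite V" "card V = CARD('n)"
    using V(2) independent_bound dim_eq_card[of V UNIV] by auto
  then obtain b :: "'n \<Rightarrow> real^'n" where b: "bij_betw b UNIV V"
    using finite_same_card_bij[of "UNIV::'n set" V] by auto
  then have b_eigen: "norm (b i) = 1 \<and> (\<exists>c. A *v b i = c *\<^sub>R b i)" for i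
    using eigen by (auto simp: bij_betw_def)
  then obtain c where c: "\<And>i. A *v b i = c i *\<^sub>R b i" by metis
  define P where "P = (\<chi> i j. b j $ i)"
  have column_P: "column j P = b j" for j by (simp add: P_def column_def vec_eq_iff)
  have "orthogonal (b i) (b j)" if "i \<noteq> j" for i j
    using V(1) b that by (metis bij_betw_def injD pairwiseD rangeI)
  then have P: "orthogonal_matrix P"
    using b_eigen by (simp add: orthogonal_matrix_orthonormal_columns column_P)
  have "(A ** P) $ i $ j = (A *v b j) $ i" for i j
    by (simp add: P_def matrix_matrix_mult_def matrix_vector_mult_def)
  then have "A ** P = P ** diag_mat (\<chi> i. c i)"
    by (simp add: matrix_mult_diag_mat vec_eq_iff c P_def)
  then have "A ** (P ** transpose P) = spectral_mat P (\<chi> i. c i)"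
    by (simp add: spectral_mat_def matrix_mul_assoc)
  then show thesis using that P by (simp add: orthogonal_matrix_def)
qed

lemma eigenvalues_orthogonal_congruence:
  fixes B :: "real^'n^'n"
  assumes C: "orthogonal_matrix C"
  shows "eigenvalues (transpose C ** B ** C) = eigenvalues B"
proof -
  have subset: "eigenvalues B \<subseteq> eigenvalues (transpose C ** B ** C)"
    if C: "orthogonal_matrix C" for B C :: "real^'n^'n"
  proof
    fix c assume "c \<in> eigenvalues B"
    then obtain v where v: "v \<noteq> 0" "B *v v = c *\<^sub>R v" by (auto simp: eigenvalues_def)
    have CC: "C *v (transpose C *v u) = u" for u
      using C by (simp only: matrix_vector_mul_assoc orthogonal_matrix_def matrix_vector_mul_lid)
    have "(transpose C ** B ** C) *v (transpose C *v v) = c *\<^sub>R (transpose C *v v)"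
      by (simp only: matrix_vector_mul_assoc[symmetric] CC v matrix_vector_mult_scaleR)
    moreover have "transpose C *v v \<noteq> 0" using CC[of v] v by (metis matrix_vector_mult_0_right)
    ultimately show "c \<in> eigenvalues (transpose C ** B ** C)" unfolding eigenvalues_def by blast
  qed
  have "C ** (transpose C ** B ** C) ** transpose C = (C ** transpose C) ** B ** (C ** transpose C)"
    by (simp only: matrix_mul_assoc)
  then have "C ** (transpose C ** B ** C) ** transpose C = B"
    using C by (simp add: orthogonal_matrix_def)
  then show ?thesis
    using subset[OF C, of B] subset[of "transpose C" "transpose C ** B ** C"] C by simp
qed

lemma eigenvalues_diag_mat: "eigenvalues (diag_mat x) = range (($) x)"
proof
  show "eigenvalues (diag_mat x) \<subseteq> range (($) x)"
    by (auto simp: eigenvalues_def diag_mat_mult_vec vec_eq_iff)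
  have "diag_mat x *v axis i 1 = x $ i *\<^sub>R axis i 1" for i
    by (simp add: diag_mat_mult_vec vec_eq_iff axis_def)
  moreover have "axis i (1::real) \<noteq> 0" for i :: 'a
    by simp
  ultimately show "range (($) x) \<subseteq> eigenvalues (diag_mat x)"
    unfolding eigenvalues_def by blast
qed

lemma eigenvalues_spectral_mat:
  assumes "orthogonal_matrix P"
  shows "eigenvalues (spectral_mat P x) = range (($) x)"
  using eigenvalues_orthogonal_congruence[of "transpose P" "diag_mat x"] assms
  by (simp add: spectral_mat_def eigenvalues_diag_mat)

section \<open>Matrix calculus\<close>

lemma bounded_bilinear_matrix_matrix_mult:
  "bounded_bilinear ((**) :: real^'n^'m \<Rightarrow> real^'p^'n \<Rightarrow> real^'p^'m)"
proof -
  have "bilinear ((**) :: real^'n^'m \<Rightarrow> real^'p^'n \<Rightarrow> real^'p^'m)"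
    unfolding bilinear_def
    by (auto intro!: linearI simp: matrix_matrix_mult_def vec_eq_iff sum.distrib
        sum_distrib_left algebra_simps)
  then show ?thesis by (simp add: bilinear_conv_bounded_bilinear)
qed

lemma bounded_linear_transpose: "bounded_linear (transpose :: real^'n^'m \<Rightarrow> real^'m^'n)"
  unfolding linear_conv_bounded_linear[symmetric]
  by (rule linearI) (simp_all add: transpose_def vec_eq_iff)

lemma bounded_linear_spectral_mat: "bounded_linear (spectral_mat P)"
  using linear_spectral_mat by (simp add: linear_conv_bounded_linear)

lemmas transpose_add = linear_add[OF bounded_linear.linear[OF bounded_linear_transpose]]
lemmas transpose_diff = linear_diff[OF bounded_linear.linear[OF bounded_linear_transpose]]
lemmas continuous_on_matrix_matrix_mult [continuous_intros] =
  bounded_bilinear.continuous_on[OF bounded_bilinear_matrix_matrix_mult]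
lemmas continuous_on_transpose [continuous_intros] =
  bounded_linear.continuous_on[OF bounded_linear_transpose]
lemmas continuous_on_spectral_mat [continuous_intros] =
  bounded_linear.continuous_on[OF bounded_linear_spectral_mat]
lemmas has_derivative_matrix_matrix_mult [derivative_intros] =
  bounded_bilinear.FDERIV[OF bounded_bilinear_matrix_matrix_mult]
lemmas has_derivative_transpose [derivative_intros] =
  bounded_linear.has_derivative[OF bounded_linear_transpose]
lemmas has_derivative_spectral_mat [derivative_intros] =
  bounded_linear.has_derivative[OF bounded_linear_spectral_mat]

lemma continuous_on_matpow [continuous_intros]:
  "continuous_on S f \<Longrightarrow> continuous_on S (\<lambda>x. matpow (f x) k)"
  by (induction k) (auto intro!: continuous_intros)

lemma inner_matrix_eq_trace: "(X :: real^'n^'m) \<bullet> Y = trace (transpose X ** Y)"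
  unfolding inner_vec_def trace_def matrix_matrix_mult_def transpose_def
  by simp (rule sum.swap)

lemma inner_transpose: "(X :: real^'n^'m) \<bullet> transpose Y = transpose X \<bullet> Y"
  unfolding inner_matrix_eq_trace
  by (metis inner_commute inner_matrix_eq_trace trace_mul_sym transpose_transpose)

lemma inner_matrix_mult_left:
  "(X :: real^'p^'m) \<bullet> ((A :: real^'n^'m) ** L) = (transpose A ** X) \<bullet> L"
  by (simp add: inner_matrix_eq_trace matrix_transpose_mul matrix_mul_assoc)

lemma subspace_sym_mat: "subspace {X. sym_mat X}"
  by (simp add: subspace_def sym_mat_def transpose_add transpose_scalar)
    (simp add: transpose_def vec_eq_iff)

section \<open>Obstructions to the strong spectral and multiplicity properties\<close>

text \<open>The zero pattern of \<open>X\<close> is prescribed by \<open>E\<close> and not by \<open>A\<close>, so that all conditions are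
  closed in \<open>(X, A)\<close>.\<close>
definition strong_obstructions ::
  "('n::finite \<Rightarrow> 'n \<Rightarrow> bool) \<Rightarrow> nat \<Rightarrow> real^'n^'n \<Rightarrow> (real^'n^'n) set" where
  "strong_obstructions E m A = {X. sym_mat X \<and> (\<forall>i j. i = j \<or> E i j \<longrightarrow> X $ i $ j = 0)
      \<and> A ** X = X ** A \<and> (\<forall>k<m. trace (matpow A k ** X) = 0)}"

lemma subspace_strong_obstructions: "subspace (strong_obstructions E m A)"
proof (rule subspaceI)
  note matrix_mult_linear_simps = bounded_bilinear.add_left[OF bounded_bilinear_matrix_matrix_mult]
    matrix_add_ldistrib scalar_matrix_assoc[symmetric] matrix_scalar_ac
  show "0 \<in> strong_obstructions E m A"
    using subspace_0[OF subspace_sym_mat] by (simp add: strong_obstructions_def trace_def)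
  show "X + Y \<in> strong_obstructions E m A"
    if "X \<in> strong_obstructions E m A" "Y \<in> strong_obstructions E m A" for X Y
    using that subspace_add[OF subspace_sym_mat, of X Y]
    by (simp add: strong_obstructions_def matrix_mult_linear_simps trace_add)
  show "c *\<^sub>R X \<in> strong_obstructions E m A" if "X \<in> strong_obstructions E m A" for c X
    using that subspace_scale[OF subspace_sym_mat, of X c]
    by (simp add: strong_obstructions_def matrix_mult_linear_simps trace_def
        sum_distrib_left[symmetric])
qed

lemma strong_obstructions_trivial_mono:
  assumes "strong_obstructions E m A = {0}" "m \<le> m'"
  shows "strong_obstructions E m' A = {0}"
proof -
  have "strong_obstructions E m' A \<subseteq> strong_obstructions E m A"
    using assms(2) by (auto simp: strong_obstructions_def)
  then show ?thesis
    using assms(1) subspace_0[OF subspace_strong_obstructions[of E m' A]] by auto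
qed

lemma strong_obstructions_trivial_iff:
  assumes "simple_graph E" "A \<in> SG E"
  shows "strong_obstructions E m A = {0} \<longleftrightarrow>
    (\<forall>X. sym_mat X \<and> (\<forall>i j. A $ i $ j * X $ i $ j = 0) \<and> (\<forall>i. X $ i $ i = 0)
      \<and> A ** X - X ** A = 0 \<and> (\<forall>k<m. trace (matpow A k ** X) = 0) \<longrightarrow> X = 0)"
proof -
  have "i \<noteq> j \<and> A $ i $ j \<noteq> 0 \<longleftrightarrow> E i j" for i j
    using assms by (cases "i = j") (auto simp: SG_def simple_graph_def)
  then have "(\<forall>i j. i = j \<or> E i j \<longrightarrow> X $ i $ j = 0)
      \<longleftrightarrow> (\<forall>i j. A $ i $ j * X $ i $ j = 0) \<and> (\<forall>i. X $ i $ i = 0)" for X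
    by (metis mult_eq_0_iff)
  moreover have "strong_obstructions E m A = {0} \<longleftrightarrow> (\<forall>X. X \<in> strong_obstructions E m A \<longrightarrow> X = 0)"
    using subspace_0[OF subspace_strong_obstructions] by blast
  ultimately show ?thesis
    by (simp add: strong_obstructions_def conj_assoc)
qed

lemma SSP_iff_strong_obstructions_trivial:
  assumes "simple_graph E" "A \<in> SG E"
  shows "SSP A \<longleftrightarrow> strong_obstructions E 0 A = {0}"
  by (simp add: SSP_def strong_obstructions_trivial_iff[OF assms])

lemma SMP_iff_strong_obstructions_trivial:
  assumes "simple_graph E" "A \<in> SG E"
  shows "SMP A \<longleftrightarrow> strong_obstructions E (qnum A) A = {0}"
  by (simp add: SMP_def strong_obstructions_trivial_iff[OF assms])

lemma open_trivial_subspace: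
  fixes Z :: "'a::euclidean_space \<Rightarrow> 'b::euclidean_space set"
  assumes Z: "\<And>a. subspace (Z a)" and closed: "closed {(x, a). x \<in> Z a}"
  shows "open {a. Z a = {0}}"
proof -
  have "Z a \<noteq> {0} \<longleftrightarrow> (\<exists>x. x \<in> sphere 0 1 \<and> x \<in> Z a)" for a
  proof
    assume "Z a \<noteq> {0}"
    then obtain x where "x \<in> Z a" "x \<noteq> 0" using subspace_0[OF Z] by blast
    then have "x /\<^sub>R norm x \<in> sphere 0 1 \<and> x /\<^sub>R norm x \<in> Z a"
      using Z by (simp add: subspace_scale)
    then show "\<exists>x. x \<in> sphere 0 1 \<and> x \<in> Z a" by blast
  qed force
  then have "{a. Z a = {0}} = - {a. \<exists>x. x \<in> sphere 0 1 \<and> (x, a) \<in> {(x, a). x \<in> Z a}}"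
    by blast
  moreover have "closed {a. \<exists>x. x \<in> sphere 0 1 \<and> (x, a) \<in> {(x, a). x \<in> Z a}}"
    by (rule closed_compact_projection[OF compact_sphere closed])
  ultimately show ?thesis by (simp add: open_Compl)
qed

lemma open_strong_obstructions_trivial:
  "open {A. strong_obstructions E m A = {0}}"
proof (rule open_trivial_subspace[OF subspace_strong_obstructions])
  have "closed {z. sym_mat (fst z) \<and> (\<forall>i j. i = j \<or> E i j \<longrightarrow> fst z $ i $ j = 0)
      \<and> snd z ** fst z = fst z ** snd z \<and> (\<forall>k<m. trace (matpow (snd z) k ** fst z) = 0)}"
    unfolding trace_def sym_mat_def
    by (intro closed_Collect_conj closed_Collect_all closed_Collect_imp open_Collect_const
        closed_Collect_eq continuous_intros)
  then show "closed {(X, A). X \<in> strong_obstructions E m A}"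
    by (simp add: strong_obstructions_def case_prod_unfold)
qed

section \<open>Open mappings between subspaces\<close>

lemma subspace_projection_exists:
  fixes V :: "'a::euclidean_space set"
  assumes "subspace V"
  obtains p where "linear p" "\<And>x. p x \<in> V" "\<And>x. x \<in> V \<Longrightarrow> p x = x"
  using linear_exists_left_inverse_on[OF linear_id assms] by auto

lemma subspace_subset_if_no_orthogonal:
  fixes R :: "'a::euclidean_space set"
  assumes "subspace R" "subspace T" "R \<subseteq> T"
    and "\<And>w. w \<in> T \<Longrightarrow> (\<And>r. r \<in> R \<Longrightarrow> w \<bullet> r = 0) \<Longrightarrow> w = 0"
  shows "T \<subseteq> R"
proof (rule ccontr)
  assume "\<not> T \<subseteq> R"
  then have "span R \<subset> span T" using assms(1-3) by (auto simp: span_eq_iff[THEN iffD2])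
  then obtain w where "w \<noteq> 0" "w \<in> span T" "\<And>r. r \<in> span R \<Longrightarrow> orthogonal w r"
    using orthogonal_to_subspace_exists_gen by blast
  then show False
    using assms by (auto simp: span_eq_iff[THEN iffD2] orthogonal_def)
qed

lemma surj_add_projection_complement:
  fixes f :: "'a \<Rightarrow> 'b::ab_group_add"
  assumes "\<And>y. r y \<in> T" "T \<subseteq> range f"
  shows "surj (\<lambda>z. f (fst z) + (snd z - r (snd z)))"
  unfolding surj_def
proof
  fix y
  have "r y \<in> range f" using assms(2,1) by (rule subsetD)
  then obtain u where "r y = f u" by blast
  then have "y = f (fst (u, y)) + (snd (u, y) - r (snd (u, y)))" by simp
  then show "\<exists>z. y = f (fst z) + (snd z - r (snd z))" ..
qed

lemma eq_if_differ_by_projection_complement: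
  assumes T: "subspace T" and r: "linear r" "\<And>y. r y \<in> T" "\<And>y. y \<in> T \<Longrightarrow> r y = y"
    and "y \<in> T" "z \<in> T" and yz: "y = z + (w - r w)"
  shows "y = z"
proof -
  have "y - z \<in> T" using T \<open>y \<in> T\<close> \<open>z \<in> T\<close> by (rule subspace_diff)
  then have "w - r w = r (w - r w)" by (simp add: yz r(3))
  also have "\<dots> = 0" by (simp add: linear_diff[OF r(1)] r)
  finally show ?thesis by (simp add: yz)
qed

lemma surj_derivative_imp_mem_interior_image:
  fixes f :: "'a::euclidean_space \<Rightarrow> 'b::euclidean_space"
  assumes "open S" "x \<in> S" "continuous_on S f" and f': "(f has_derivative f') (at x)" and "surj f'"
  shows "f x \<in> interior (f ` S)"
proof -
  have "linear f'" using has_derivative_bounded_linear[OF f'] by (rule bounded_linear.linear)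
  then obtain g where "bounded_linear g" "f' \<circ> g = id"
    using linear_surjective_right_inverse[OF _ \<open>surj f'\<close>] by (auto simp: linear_conv_bounded_linear)
  then show ?thesis
    using assms(1-3) by (intro sussmann_open_mapping[OF _ _ _ f']) (auto simp: interior_open)
qed

text \<open>Adding a complement of \<open>T\<close> as extra parameters makes the derivative onto the whole space;
  the extra component vanishes on preimages of points of \<open>T\<close>.\<close>
lemma open_mapping_onto_subspace:
  fixes f :: "'a::euclidean_space \<Rightarrow> 'b::euclidean_space"
  assumes T: "subspace T" "f ` S \<subseteq> T"
    and S: "open S" "x \<in> S" and contf: "continuous_on S f"
    and f': "(f has_derivative f') (at x)" and onto: "T \<subseteq> range f'"
  obtains \<delta> where "\<delta> > 0" "T \<inter> ball (f x) \<delta> \<subseteq> f ` S"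
proof -
  obtain r where r: "linear r" "\<And>y. r y \<in> T" "\<And>y. y \<in> T \<Longrightarrow> r y = y"
    using subspace_projection_exists[OF T(1)] by metis
  have complement: "bounded_linear (\<lambda>z :: 'a \<times> 'b. snd z - r (snd z))"
    using r(1) unfolding linear_conv_bounded_linear
    by (intro bounded_linear_sub bounded_linear_snd bounded_linear_compose[OF _ bounded_linear_snd])
  define F where "F = (\<lambda>z. f (fst z) + (snd z - r (snd z)))"
  define F' where "F' = (\<lambda>h. f' (fst h) + (snd h - r (snd h)))"
  have "((\<lambda>z. f (fst z)) has_derivative (\<lambda>h. f' (fst h))) (at (x, 0::'b))"
    by (rule has_derivative_compose[OF bounded_linear_imp_has_derivative[OF bounded_linear_fst]])
      (simp add: f')
  then have "(F has_derivative F') (at (x, 0))"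
    unfolding F_def F'_def
    by (rule has_derivative_add[OF _ bounded_linear_imp_has_derivative[OF complement]])
  moreover have "surj F'"
    unfolding F'_def using r(2) onto by (rule surj_add_projection_complement)
  moreover have "continuous_on (S \<times> UNIV) F"
    unfolding F_def
    by (intro continuous_on_add linear_continuous_on[OF complement]
        continuous_on_compose2[OF contf continuous_on_fst[OF continuous_on_id]]) auto
  ultimately have "F (x, 0) \<in> interior (F ` (S \<times> UNIV))"
    using S by (intro surj_derivative_imp_mem_interior_image) (auto intro: open_Times)
  moreover have "F (x, 0) = f x" by (simp add: F_def linear_0[OF r(1)])
  ultimately obtain \<delta> where \<delta>: "\<delta> > 0" "ball (f x) \<delta> \<subseteq> F ` (S \<times> UNIV)"
    by (auto simp: mem_interior)
  have "y \<in> f ` S" if y: "y \<in> T" "y \<in> ball (f x) \<delta>" for y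
  proof -
    obtain u w where preimage: "u \<in> S" "y = f u + (w - r w)"
      using y(2) \<delta>(2) by (auto simp: F_def)
    then have "f u \<in> T" using T(2) by blast
    then have "y = f u"
      using eq_if_differ_by_projection_complement[OF T(1) r y(1) _ preimage(2)] by blast
    then show ?thesis using preimage(1) by blast
  qed
  then show thesis using that \<delta>(1) by blast
qed

lemma open_mapping_between_subspaces:
  fixes f :: "'a::euclidean_space \<Rightarrow> 'b::euclidean_space"
  assumes V: "subspace V" "x \<in> V" and T: "subspace T" "f ` (V \<inter> S) \<subseteq> T"
    and S: "open S" "x \<in> S" and contf: "continuous_on S f"
    and f': "(f has_derivative f') (at x)" and onto: "T \<subseteq> f' ` V"
  obtains \<delta> where "\<delta> > 0" "T \<inter> ball (f x) \<delta> \<subseteq> f ` (V \<inter> S)"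
proof -
  obtain p where p: "linear p" "\<And>u. p u \<in> V" "\<And>v. v \<in> V \<Longrightarrow> p v = v"
    using subspace_projection_exists[OF V(1)] by metis
  have bounded_p: "bounded_linear p" using p(1) by (simp add: linear_conv_bounded_linear)
  have image: "(\<lambda>u. f (p u)) ` (p -` S) \<subseteq> f ` (V \<inter> S)" using p(2) by auto
  obtain \<delta> where \<delta>: "\<delta> > 0" "T \<inter> ball (f (p x)) \<delta> \<subseteq> (\<lambda>u. f (p u)) ` (p -` S)"
  proof (rule open_mapping_onto_subspace[OF T(1)])
    show "(\<lambda>u. f (p u)) ` (p -` S) \<subseteq> T" using image T(2) by (rule order_trans)
    show "open (p -` S)" by (rule open_vimage[OF S(1) linear_continuous_on[OF bounded_p]])
    show "x \<in> p -` S" using S(2) by (simp add: p(3) V(2))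
    show "continuous_on (p -` S) (\<lambda>u. f (p u))"
      by (intro continuous_on_compose2[OF contf linear_continuous_on[OF bounded_p]]) auto
    show "((\<lambda>u. f (p u)) has_derivative (\<lambda>h. f' (p h))) (at x)"
      by (rule has_derivative_compose[OF bounded_linear_imp_has_derivative[OF bounded_p]])
        (simp add: p(3) V(2) f')
    have "f' v \<in> range (\<lambda>h. f' (p h))" if "v \<in> V" for v
      using that by (intro range_eqI[of _ _ v]) (simp add: p(3))
    then show "T \<subseteq> range (\<lambda>h. f' (p h))" using onto by auto
  qed
  then show thesis using that image by (simp add: p(3) V(2))
qed

section \<open>Perturbation within the pattern of a graph\<close>

definition pattern_space :: "('n::finite \<Rightarrow> 'n \<Rightarrow> bool) \<Rightarrow> (real^'n^'n) set" where
  "pattern_space E = {B. sym_mat B \<and> (\<forall>i j. i \<noteq> j \<and> \<not> E i j \<longrightarrow> B $ i $ j = 0)}"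

lemma subspace_pattern_space:
  fixes E :: "'n::finite \<Rightarrow> 'n \<Rightarrow> bool"
  shows "subspace (pattern_space E)"
proof -
  have "subspace {B :: real^'n^'n. \<forall>i j. i \<noteq> j \<and> \<not> E i j \<longrightarrow> B $ i $ j = 0}"
    by (simp add: subspace_def)
  moreover have "pattern_space E = {B. sym_mat B} \<inter> {B. \<forall>i j. i \<noteq> j \<and> \<not> E i j \<longrightarrow> B $ i $ j = 0}"
    by (simp only: pattern_space_def Collect_conj_eq)
  ultimately show ?thesis
    by (simp only: subspace_inter[OF subspace_sym_mat])
qed

lemma SG_eq_pattern_space_Int:
  assumes "simple_graph E"
  shows "SG E = pattern_space E \<inter> {B. \<forall>i j. E i j \<longrightarrow> B $ i $ j \<noteq> 0}"
proof -
  have "i \<noteq> j" if "E i j" for i j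
    using assms that by (auto simp: simple_graph_def)
  then show ?thesis unfolding SG_def pattern_space_def by blast
qed

lemma open_nonzero_entries:
  fixes E :: "'n::finite \<Rightarrow> 'n \<Rightarrow> bool"
  shows "open {B :: real^'n^'n. \<forall>i j. E i j \<longrightarrow> B $ i $ j \<noteq> 0}"
proof -
  have "open (\<Inter>(i, j)\<in>{(i, j). E i j}. {B :: real^'n^'n. B $ i $ j \<noteq> 0})"
    by (intro open_INT) (auto intro!: open_Collect_neq continuous_intros)
  also have "(\<Inter>(i, j)\<in>{(i, j). E i j}. {B :: real^'n^'n. B $ i $ j \<noteq> 0})
      = {B. \<forall>i j. E i j \<longrightarrow> B $ i $ j \<noteq> 0}"
    by auto
  finally show ?thesis .
qed

lemma vanishes_if_orthogonal_to_pattern_space: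
  assumes E: "simple_graph E" and X: "sym_mat X"
    and orth: "\<And>B. B \<in> pattern_space E \<Longrightarrow> X \<bullet> B = 0" and ij: "i = j \<or> E i j"
  shows "X $ i $ j = 0"
proof -
  define B where "B = (\<chi> i j. if i = j \<or> E i j then X $ i $ j else 0)"
  have "X $ j $ i = X $ i $ j" for i j
    using X unfolding sym_mat_def transpose_def by (metis vec_lambda_beta)
  then have "B \<in> pattern_space E"
    using E
    by (auto simp: B_def pattern_space_def sym_mat_def transpose_def vec_eq_iff simple_graph_def)
  then have "X \<bullet> B = 0" by (rule orth)
  moreover have "X \<bullet> B = B \<bullet> B"
    unfolding inner_vec_def by (intro sum.cong refl) (simp add: B_def)
  ultimately have "B $ i $ j = 0" by simp
  then show ?thesis using ij by (simp add: B_def)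
qed

definition fibre_constant :: "real^'n \<Rightarrow> (real^'n) set" where
  "fibre_constant d = {x. \<forall>i j. d $ i = d $ j \<longrightarrow> x $ i = x $ j}"

lemma subspace_fibre_constant: "subspace (fibre_constant d)"
proof (rule subspaceI)
  show "x + y \<in> fibre_constant d" if "x \<in> fibre_constant d" "y \<in> fibre_constant d" for x y
    using that unfolding fibre_constant_def mem_Collect_eq vector_add_component by metis
  show "c *\<^sub>R x \<in> fibre_constant d" if "x \<in> fibre_constant d" for c x
    using that unfolding fibre_constant_def mem_Collect_eq vector_scaleR_component by metis
qed (simp add: fibre_constant_def)

definition congruence_map ::
  "real^'n^'n \<Rightarrow> (real^'n^'n) \<times> (real^'n^'n) \<times> (real^'n) \<Rightarrow> (real^'n^'n) \<times> (real^'n^'n)" where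
  "congruence_map P = (\<lambda>(B, C, x).
     (transpose C ** B ** C - spectral_mat P x, transpose C ** C))"

definition congruence_deriv ::
  "real^'n^'n \<Rightarrow> real^'n^'n \<Rightarrow> (real^'n^'n) \<times> (real^'n^'n) \<times> (real^'n) \<Rightarrow> (real^'n^'n) \<times> (real^'n^'n)" where
  "congruence_deriv P A = (\<lambda>(Y, L, x).
     (transpose L ** A + Y + A ** L - spectral_mat P x, transpose L + L))"

lemma continuous_on_congruence_map: "continuous_on S (congruence_map P)"
  unfolding congruence_map_def case_prod_unfold by (rule continuous_intros)+

lemma congruence_map_has_derivative:
  "(congruence_map P has_derivative congruence_deriv P A) (at (A, mat 1, x))"
  unfolding congruence_map_def congruence_deriv_def case_prod_unfold
  by (rule has_derivative_eq_rhs, (rule derivative_intros)+) (simp add: fun_eq_iff algebra_simps)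

lemma congruence_map_symmetric:
  assumes "sym_mat (fst z)"
  shows "congruence_map P z \<in> {M. sym_mat M} \<times> {M. sym_mat M}"
  using assms sym_mat_spectral_mat
  by (simp add: congruence_map_def case_prod_unfold sym_mat_def transpose_diff
      matrix_transpose_mul matrix_mul_assoc)

lemma congruence_deriv_symmetric:
  assumes "sym_mat A" "sym_mat (fst z)"
  shows "congruence_deriv P A z \<in> {M. sym_mat M} \<times> {M. sym_mat M}"
  using assms sym_mat_spectral_mat
  by (simp add: congruence_deriv_def case_prod_unfold sym_mat_def transpose_add transpose_diff
      matrix_transpose_mul add_ac)

lemma inner_pair_symmetrized_mult:
  assumes A: "sym_mat A" and X: "sym_mat X" and Z: "sym_mat Z"
  shows "(X, Z) \<bullet> (transpose L ** A + A ** L, transpose L + L) = 2 * ((A ** X + Z) \<bullet> L)"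
proof -
  have "X \<bullet> (transpose L ** A) = X \<bullet> transpose (A ** L)"
    using A by (simp add: matrix_transpose_mul sym_mat_def)
  also have "\<dots> = X \<bullet> (A ** L)"
    using X by (simp add: inner_transpose sym_mat_def)
  finally show ?thesis
    using A Z inner_matrix_mult_left[of X A L] inner_transpose[of Z L]
    by (simp add: inner_add sym_mat_def)
qed

lemma orthogonal_to_congruence_deriv:
  assumes E: "simple_graph E" and P: "orthogonal_matrix P" and A: "A = spectral_mat P d"
    and X: "sym_mat X" and Z: "sym_mat Z"
    and orth: "\<And>Y L x. Y \<in> pattern_space E \<Longrightarrow> x \<in> fibre_constant d
      \<Longrightarrow> (X, Z) \<bullet> congruence_deriv P A (Y, L, x) = 0"
  shows "X \<in> strong_obstructions E m A" "A ** X + Z = 0"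
proof -
  note zero_mem = subspace_0[OF subspace_pattern_space] subspace_0[OF subspace_fibre_constant]
  note zero_simps = linear_0[OF linear_spectral_mat]
    linear_0[OF bounded_linear.linear[OF bounded_linear_transpose]]
  have A_sym: "sym_mat A" by (simp add: A sym_mat_spectral_mat)
  have "X \<bullet> Y = 0" if "Y \<in> pattern_space E" for Y
    using orth[OF that zero_mem(2), of 0] by (simp add: congruence_deriv_def zero_simps)
  then have pattern: "X $ i $ j = 0" if "i = j \<or> E i j" for i j
    using vanishes_if_orthogonal_to_pattern_space[OF E X _ that] by blast
  have "(A ** X + Z) \<bullet> L = 0" for L
    using orth[OF zero_mem, of L] inner_pair_symmetrized_mult[OF A_sym X Z, of L]
    by (simp add: congruence_deriv_def zero_simps)
  from this[of "A ** X + Z"] show AXZ: "A ** X + Z = 0" by simp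
  have "X ** A + Z = transpose (A ** X + Z)"
    using X Z A_sym by (simp add: transpose_add matrix_transpose_mul sym_mat_def)
  then have commute: "A ** X = X ** A"
    using AXZ zero_simps(2) by (metis add_right_cancel)
  have "trace (matpow A k ** X) = 0" for k
  proof -
    have "(\<chi> i. d $ i ^ k) \<in> fibre_constant d" by (simp add: fibre_constant_def)
    then have "X \<bullet> spectral_mat P (\<chi> i. d $ i ^ k) = 0"
      using orth[OF zero_mem(1), of _ 0] by (simp add: congruence_deriv_def zero_simps)
    then have "X \<bullet> matpow A k = 0"
      by (simp add: A matpow_spectral_mat[OF P])
    then show ?thesis
      using X unfolding inner_matrix_eq_trace sym_mat_def
      by (simp add: trace_mul_sym[of "matpow A k"])
  qed
  then show "X \<in> strong_obstructions E m A"
    using X pattern commute by (simp add: strong_obstructions_def)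
qed

lemma congruence_deriv_onto_symmetric:
  fixes A :: "real^'n^'n"
  assumes E: "simple_graph E" and P: "orthogonal_matrix P" and A: "A = spectral_mat P d"
    and trivial: "strong_obstructions E m A = {0}"
  shows "{M. sym_mat M} \<times> {M. sym_mat M}
    \<subseteq> congruence_deriv P A ` (pattern_space E \<times> UNIV \<times> fibre_constant d)"
proof (rule subspace_subset_if_no_orthogonal)
  have "linear (congruence_deriv P A)"
    by (rule bounded_linear.linear[OF has_derivative_bounded_linear[OF congruence_map_has_derivative]])
  then show "subspace (congruence_deriv P A ` (pattern_space E \<times> UNIV \<times> fibre_constant d))"
    by (rule linear_subspace_image)
      (rule subspace_Times subspace_pattern_space subspace_fibre_constant subspace_UNIV)+
  show "subspace ({M :: real^'n^'n. sym_mat M} \<times> {M :: real^'n^'n. sym_mat M})"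
    by (intro subspace_Times subspace_sym_mat)
  show "congruence_deriv P A ` (pattern_space E \<times> UNIV \<times> fibre_constant d)
      \<subseteq> {M. sym_mat M} \<times> {M. sym_mat M}"
    by (intro image_subsetI congruence_deriv_symmetric)
      (auto simp: A sym_mat_spectral_mat pattern_space_def)
next
  fix w assume "w \<in> {M :: real^'n^'n. sym_mat M} \<times> {M :: real^'n^'n. sym_mat M}"
    and orth: "\<And>r. r \<in> congruence_deriv P A ` (pattern_space E \<times> UNIV \<times> fibre_constant d)
      \<Longrightarrow> w \<bullet> r = 0"
  then obtain X Z where w: "w = (X, Z)" "sym_mat X" "sym_mat Z" by auto
  have "(X, Z) \<bullet> congruence_deriv P A (Y, L, x) = 0"
    if "Y \<in> pattern_space E" "x \<in> fibre_constant d" for Y L x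
    using orth that w(1) by blast
  then have "X \<in> strong_obstructions E m A" "A ** X + Z = 0"
    using orthogonal_to_congruence_deriv[OF E P A w(2,3)] by blast+
  then show "w = 0" using trivial w(1) by (simp add: zero_prod_def)
qed

lemma congruence_map_locally_onto_symmetric:
  fixes A :: "real^'n^'n"
  assumes E: "simple_graph E" and A: "A \<in> pattern_space E"
    and P: "orthogonal_matrix P" and A_eq: "A = spectral_mat P d"
    and trivial: "strong_obstructions E m A = {0}"
    and U: "open U" "(A, mat 1, 0) \<in> U"
  obtains \<delta> where "\<delta> > 0"
    "({M. sym_mat M} \<times> {M. sym_mat M}) \<inter> ball (A, mat 1) \<delta>
      \<subseteq> congruence_map P ` ((pattern_space E \<times> UNIV \<times> fibre_constant d) \<inter> U)"
proof -
  let ?V = "pattern_space E \<times> (UNIV :: (real^'n^'n) set) \<times> fibre_constant d"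
    and ?T = "{M :: real^'n^'n. sym_mat M} \<times> {M :: real^'n^'n. sym_mat M}"
  have V: "subspace ?V" "(A, mat 1, 0) \<in> ?V"
    using A by (auto intro!: subspace_Times subspace_pattern_space subspace_fibre_constant
        subspace_0[OF subspace_fibre_constant])
  have T: "subspace ?T" "congruence_map P ` (?V \<inter> U) \<subseteq> ?T"
    by (intro subspace_Times subspace_sym_mat)
      (intro image_subsetI congruence_map_symmetric, auto simp: pattern_space_def)
  have base: "congruence_map P (A, mat 1, 0) = (A, mat 1)"
    by (simp add: congruence_map_def linear_0[OF linear_spectral_mat])
  obtain \<delta> where "\<delta> > 0" "?T \<inter> ball (A, mat 1) \<delta> \<subseteq> congruence_map P ` (?V \<inter> U)"
    using open_mapping_between_subspaces[OF V T U continuous_on_congruence_map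
        congruence_map_has_derivative congruence_deriv_onto_symmetric[OF E P A_eq trivial]]
    unfolding base by blast
  then show thesis by (rule that)
qed

lemma eigenvalues_if_congruence_map_eq_spectral_mat:
  assumes P: "orthogonal_matrix P" and eq: "congruence_map P (B, C, x) = (spectral_mat P u, mat 1)"
  shows "eigenvalues B = range (($) (u + x))"
proof -
  have C: "orthogonal_matrix C" and "transpose C ** B ** C = spectral_mat P (u + x)"
    using eq by (simp_all add: congruence_map_def orthogonal_matrix linear_add[OF linear_spectral_mat]
        diff_eq_eq)
  then show ?thesis
    using eigenvalues_orthogonal_congruence[OF C, of B] by (simp add: eigenvalues_spectral_mat[OF P])
qed

lemma nearby_spectra_realizable:
  fixes A :: "real^'n^'n"
  assumes E: "simple_graph E" and A: "A \<in> SG E"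
    and P: "orthogonal_matrix P" and A_eq: "A = spectral_mat P d"
    and trivial: "strong_obstructions E m A = {0}" and \<epsilon>: "\<epsilon> > 0"
  obtains \<delta> where "\<delta> > 0"
    "\<And>f. norm f < \<delta> \<Longrightarrow> \<exists>B\<in>SG E. strong_obstructions E m B = {0}
      \<and> (\<exists>x\<in>fibre_constant d. norm x < \<epsilon> \<and> eigenvalues B = range (($) (d + f + x)))"
proof -
  define W where
    "W = {B. strong_obstructions E m B = {0}} \<inter> {B :: real^'n^'n. \<forall>i j. E i j \<longrightarrow> B $ i $ j \<noteq> 0}"
  have "open W"
    unfolding W_def by (intro open_Int open_strong_obstructions_trivial open_nonzero_entries)
  have A_pattern_W: "A \<in> pattern_space E" "A \<in> W"
    using A trivial by (auto simp: W_def SG_eq_pattern_space_Int[OF E])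
  have U: "open (W \<times> UNIV \<times> ball 0 \<epsilon>)" "(A, mat 1, 0) \<in> W \<times> UNIV \<times> ball 0 \<epsilon>"
    using \<open>open W\<close> A_pattern_W \<epsilon> by (simp_all add: open_Times)
  obtain \<eta> where \<eta>: "\<eta> > 0" "({M. sym_mat M} \<times> {M. sym_mat M}) \<inter> ball (A, mat 1) \<eta>
      \<subseteq> congruence_map P ` ((pattern_space E \<times> UNIV \<times> fibre_constant d) \<inter> (W \<times> UNIV \<times> ball 0 \<epsilon>))"
    by (rule congruence_map_locally_onto_symmetric[OF E A_pattern_W(1) P A_eq trivial U])
  obtain K where K: "K > 0" "\<And>f. norm (spectral_mat P f) \<le> norm f * K"
    using bounded_linear.pos_bounded[OF bounded_linear_spectral_mat] by blast
  show thesis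
  proof (rule that[of "\<eta> / K"])
    fix f :: "real^'n" assume "norm f < \<eta> / K"
    then have "norm (spectral_mat P f) < \<eta>"
      using K(1) K(2)[of f] by (simp add: field_simps)
    then have "(spectral_mat P (d + f), mat 1) \<in> ball (A, mat 1) \<eta>"
      by (simp add: A_eq linear_add[OF linear_spectral_mat] dist_Pair_Pair dist_norm)
    moreover have "sym_mat (spectral_mat P (d + f))" "sym_mat (mat 1)"
      by (simp_all add: sym_mat_spectral_mat sym_mat_def[of "mat 1"])
    ultimately have "(spectral_mat P (d + f), mat 1)
        \<in> ({M. sym_mat M} \<times> {M. sym_mat M}) \<inter> ball (A, mat 1) \<eta>" by simp
    then obtain B C x where near: "B \<in> pattern_space E \<inter> W" "x \<in> fibre_constant d" "norm x < \<epsilon>"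
      and eq: "(spectral_mat P (d + f), mat 1) = congruence_map P (B, C, x)"
      using \<eta>(2) by fastforce
    have "eigenvalues B = range (($) (d + f + x))"
      by (rule eigenvalues_if_congruence_map_eq_spectral_mat[OF P eq[symmetric]])
    moreover have "B \<in> SG E" "strong_obstructions E m B = {0}"
      using near(1) by (auto simp: W_def SG_eq_pattern_space_Int[OF E])
    ultimately show "\<exists>B\<in>SG E. strong_obstructions E m B = {0}
      \<and> (\<exists>x\<in>fibre_constant d. norm x < \<epsilon> \<and> eigenvalues B = range (($) (d + f + x)))"
      using near(2,3) by blast
  qed (use \<eta>(1) K(1) in simp)
qed

section \<open>Splitting eigenvalues\<close>

lemma card_range_eq_if_same_kernel:
  assumes "\<And>i j. f i = f j \<longleftrightarrow> g i = g j"
  shows "card (range f) = card (range g)"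
proof -
  have "f (inv g (g i)) = f i" for i
    using assms by (simp add: f_inv_into_f)
  then have "(\<lambda>y. f (inv g y)) ` range g = range f"
    by (simp add: image_image)
  moreover have "inj_on (\<lambda>y. f (inv g y)) (range g)"
    by (rule inj_onI) (simp add: assms f_inv_into_f)
  ultimately show ?thesis using card_image by fastforce
qed

lemma refine_to_card_range:
  fixes d :: "real^'n"
  assumes "card (range (($) d)) \<le> q" "q \<le> CARD('n)"
  obtains f :: "real^'n" where "card (range (\<lambda>i. (d $ i, f $ i))) = q"
proof -
  define representative where "representative = (\<lambda>i. inv (($) d) (d $ i))"
  have representative: "d $ representative i = d $ i" for i
    unfolding representative_def by (rule f_inv_into_f) simp
  have "card (range representative) = card (range (($) d))"
    by (rule card_range_eq_if_same_kernel) (metis representative representative_def)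
  then obtain R where R: "range representative \<subseteq> R" "card R = q"
    using exists_subset_between[of "range representative" q UNIV] assms by auto
  define \<rho> where "\<rho> = (\<lambda>i. if i \<in> R then i else representative i)"
  have "\<rho> i \<in> R" for i using R by (auto simp: \<rho>_def)
  moreover have "\<rho> ` R = R" by (simp add: \<rho>_def)
  ultimately have "range \<rho> = R" by blast
  have d_\<rho>: "d $ \<rho> i = d $ i" for i by (simp add: \<rho>_def representative)
  obtain index :: "'n \<Rightarrow> nat" where "inj index"
    using finite_imp_inj_to_nat_seg[of "UNIV :: 'n set"] by auto
  define f :: "real^'n" where "f = (\<chi> i. real (index (\<rho> i)))"
  have "f $ i = f $ j \<longleftrightarrow> \<rho> i = \<rho> j" for i j
    using \<open>inj index\<close> by (simp add: f_def inj_eq)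
  then have "card (range (\<lambda>i. (d $ i, f $ i))) = card (range \<rho>)"
    using d_\<rho> by (intro card_range_eq_if_same_kernel) (simp, metis)
  then show thesis using that R(2) \<open>range \<rho> = R\<close> by simp
qed

lemma card_range_small_perturbation:
  fixes d :: "real^'n"
  obtains \<epsilon> where "\<epsilon> > 0"
    "\<And>f x. x \<in> fibre_constant d \<Longrightarrow> norm (f + x) < \<epsilon>
      \<Longrightarrow> card (range (($) (d + f + x))) = card (range (\<lambda>i. (d $ i, f $ i)))"
proof -
  have "finite (range (\<lambda>(i, j). d $ i - d $ j))" by simp
  from finite_set_avoid[OF this, of 0] obtain \<gamma>
    where \<gamma>: "\<gamma> > 0" "\<And>i j. d $ i \<noteq> d $ j \<Longrightarrow> \<gamma> \<le> \<bar>d $ i - d $ j\<bar>"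
    by (auto simp: dist_norm)
  show thesis
  proof (rule that[of "\<gamma> / 2"])
    fix f x assume x: "x \<in> fibre_constant d" and small: "norm (f + x) < \<gamma> / 2"
    have "\<bar>f $ i + x $ i\<bar> < \<gamma> / 2" for i
      using component_le_norm_cart[of "f + x" i] small by simp
    then have "d $ i = d $ j" if "(d + f + x) $ i = (d + f + x) $ j" for i j
      using that \<gamma>(2)[of i j] by (smt (verit) field_sum_of_halves vector_add_component)
    moreover have "(d + f + x) $ i = (d + f + x) $ j \<longleftrightarrow> f $ i = f $ j" if "d $ i = d $ j" for i j
    proof -
      have "x $ i = x $ j" using x that unfolding fibre_constant_def by blast
      then show ?thesis using that by simp
    qed
    ultimately have "(d + f + x) $ i = (d + f + x) $ j \<longleftrightarrow> (d $ i, f $ i) = (d $ j, f $ j)" for i j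
      unfolding prod.inject by blast
    then show "card (range (($) (d + f + x))) = card (range (\<lambda>i. (d $ i, f $ i)))"
      by (rule card_range_eq_if_same_kernel)
  qed (use \<gamma>(1) in simp)
qed

lemma exists_small_scaleR:
  fixes v :: "'a::real_normed_vector"
  assumes "e > 0"
  obtains t where "t > 0" "norm (t *\<^sub>R v) < e"
proof (rule that)
  have "norm v + 1 > 0" by (simp add: add_nonneg_pos)
  then show "e / (norm v + 1) > 0" "norm ((e / (norm v + 1)) *\<^sub>R v) < e"
    using assms by (simp_all add: field_simps)
qed

lemma strong_obstructions_trivial_increase_qnum:
  fixes A :: "real^'n^'n"
  assumes E: "simple_graph E" and A: "A \<in> SG E" and trivial: "strong_obstructions E m A = {0}"
    and q: "qnum A \<le> q" "q \<le> CARD('n)"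
  shows "\<exists>B\<in>SG E. strong_obstructions E m B = {0} \<and> qnum B = q"
proof -
  have "sym_mat A" using A by (simp add: SG_def)
  then obtain P d where P: "orthogonal_matrix P" and A_eq: "A = spectral_mat P d"
    by (rule sym_mat_eq_spectral_mat)
  have "card (range (($) d)) \<le> q"
    using q(1) by (simp add: qnum_def A_eq eigenvalues_spectral_mat[OF P])
  then obtain f :: "real^'n" where f: "card (range (\<lambda>i. (d $ i, f $ i))) = q"
    by (rule refine_to_card_range[OF _ q(2)])
  obtain \<epsilon> where \<epsilon>: "\<epsilon> > 0" "\<And>f x. x \<in> fibre_constant d \<Longrightarrow> norm (f + x) < \<epsilon>
      \<Longrightarrow> card (range (($) (d + f + x))) = card (range (\<lambda>i. (d $ i, f $ i)))"
    using card_range_small_perturbation[of d] by blast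
  have "\<epsilon> / 2 > 0" using \<epsilon>(1) by simp
  then obtain \<delta> where \<delta>: "\<delta> > 0" "\<And>f. norm f < \<delta> \<Longrightarrow> \<exists>B\<in>SG E. strong_obstructions E m B = {0}
      \<and> (\<exists>x\<in>fibre_constant d. norm x < \<epsilon> / 2 \<and> eigenvalues B = range (($) (d + f + x)))"
    using nearby_spectra_realizable[OF E A P A_eq trivial] by blast
  then have "min (\<epsilon> / 2) \<delta> > 0" using \<epsilon>(1) by simp
  then obtain t where "t > 0" "norm (t *\<^sub>R f) < min (\<epsilon> / 2) \<delta>"
    by (rule exists_small_scaleR)
  then have small: "norm (t *\<^sub>R f) < \<epsilon> / 2" "norm (t *\<^sub>R f) < \<delta>" by simp_all
  obtain B x where B: "B \<in> SG E" "strong_obstructions E m B = {0}"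
    and x: "x \<in> fibre_constant d" "norm x < \<epsilon> / 2"
    and eigen: "eigenvalues B = range (($) (d + t *\<^sub>R f + x))"
    using \<delta>(2)[OF small(2)] by blast
  have "qnum B = card (range (\<lambda>i. (d $ i, (t *\<^sub>R f) $ i)))"
    using \<epsilon>(2)[OF x(1), of "t *\<^sub>R f"] norm_add_less[OF small(1) x(2)]
    by (simp add: qnum_def eigen)
  also have "\<dots> = q"
    unfolding f[symmetric] using \<open>t > 0\<close> by (intro card_range_eq_if_same_kernel) auto
  finally show ?thesis using B by blast
qed

theorem theorem4p1:
  fixes E :: "'n::finite \<Rightarrow> 'n \<Rightarrow> bool" and A :: "real^'n^'n"
  assumes "simple_graph E" and "A \<in> SG E"
  shows "(SSP A \<longrightarrow> (\<forall>q'. qnum A \<le> q' \<and> q' \<le> CARD('n) \<longrightarrow>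
            (\<exists>A' \<in> SG E. SSP A' \<and> qnum A' = q')))
       \<and> (SMP A \<longrightarrow> (\<forall>q'. qnum A \<le> q' \<and> q' \<le> CARD('n) \<longrightarrow>
            (\<exists>A' \<in> SG E. SMP A' \<and> qnum A' = q')))"
proof (intro conjI impI allI; elim conjE)
  fix q' assume "SSP A" and q: "qnum A \<le> q'" "q' \<le> CARD('n)"
  then obtain A' where "A' \<in> SG E" "strong_obstructions E 0 A' = {0}" "qnum A' = q'"
    using strong_obstructions_trivial_increase_qnum[OF assms _ q]
    by (auto simp: SSP_iff_strong_obstructions_trivial[OF assms])
  then show "\<exists>A'\<in>SG E. SSP A' \<and> qnum A' = q'"
    using SSP_iff_strong_obstructions_trivial[OF assms(1)] by auto
next
  fix q' assume "SMP A" and q: "qnum A \<le> q'" "q' \<le> CARD('n)"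
  then have "strong_obstructions E q' A = {0}"
    by (simp add: SMP_iff_strong_obstructions_trivial[OF assms] strong_obstructions_trivial_mono)
  then obtain A' where "A' \<in> SG E" "strong_obstructions E q' A' = {0}" "qnum A' = q'"
    using strong_obstructions_trivial_increase_qnum[OF assms _ q, of q'] by blast
  then show "\<exists>A'\<in>SG E. SMP A' \<and> qnum A' = q'"
    using SMP_iff_strong_obstructions_trivial[OF assms(1)] by auto
qed

end
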